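(* Let $E$ be a finite-dimensional real vector space, $Q\subset E$ nonempty, convex and compact, and $h:Q\to\mathbb{R}$ concave and differentiable on $Q$, with finite curvature constant $C_{h,Q}$. Let $\{\lambda_k\}_{k\ge1}$, $\{\tilde\lambda_k\}_{k\ge1}$ and $\{B_k\}_{k\ge0}$ be the iterates and upper bounds on $h^*=\max_{\lambda\in Q}h(\lambda)$ generated by the Frank-Wolfe method with approximate subproblem solutions, with accuracies $\delta_k\ge0$ and an arbitrary step-size sequence $\{\bar\alpha_k\}_{k\ge1}\subset[0,1)$, and let $\{\alpha_k\},\{\beta_k\}$ be the associated dual averages sequences. Then for every $k\ge0$: $$B_k-h(\lambda_{k+1})\le\frac{B_k-h(\lambda_1)}{\beta_{k+1}}+\frac{\frac12C_{h,Q}\sum_{i=1}^k\frac{\alpha_i^2}{\beta_{i+1}}}{\beta_{k+1}}+\frac{\sum_{i=1}^k\alpha_i\delta_i}{\beta_{k+1}}.$$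
   Context: Notation: $E^*$ is the dual space of $E$ and $s^T\lambda$ is the evaluation of $s\in E^*$ at $\lambda\in E$; $\nabla h(\lambda)\in E^*$. Curvature constant: $C_{h,Q}$ is the minimal $C$ such that $h(\lambda+\alpha(\bar\lambda-\lambda))\ge h(\lambda)+\nabla h(\lambda)^T(\alpha(\bar\lambda-\lambda))-\frac12 C\alpha^2$ for all $\lambda,\bar\lambda\in Q$ and all $\alpha\in[0,1]$ (assumed finite). Approximate solutions: for $\delta\ge0$ and $c\in E^*$, a $\delta$-approximate solution of $\max_{\lambda\in Q}c^T\lambda$ is a point $\tilde\lambda\in Q$ with $c^T\tilde\lambda\ge\max_{\lambda\in Q}c^T\lambda-\delta$. Frank-Wolfe method with approximate subproblem solutions: start at $\lambda_1\in Q$ with an upper bound $B_0\ge h^*$ ($B_0=+\infty$ allowed if no bound is available, inequalities being then read in the extended reals). At iteration $k\ge1$: let $\tilde\lambda_k$ be any $\delta_k$-approximate solution of $\max_{\lambda\in Q}\{h(\lambda_k)+\nabla h(\lambda_k)^T(\lambda-\lambda_k)\}$ (equivalently of $\max_{\lambda\in Q}\nabla h(\lambda_k)^T\lambda$); set $B^w_k=h(\lambda_k)+\nabla h(\lambda_k)^T(\tilde\lambda_k-\lambda_k)+\delta_k$; set $B_k=\min\{B_{k-1},B^w_k,B^o_k\}$, where $B^o_k\ge h^*$ is any other (optional) upper bound on $h^*$ (omitted, or $+\infty$, if not computed); set $\lambda_{k+1}=\lambda_k+\bar\alpha_k(\tilde\lambda_k-\lambda_k)$ with $\bar\alpha_k\in[0,1)$.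 Dual averages sequences: $\beta_k=\frac{1}{\prod_{j=1}^{k-1}(1-\bar\alpha_j)}$ and $\alpha_k=\frac{\beta_k\bar\alpha_k}{1-\bar\alpha_k}$ for $k\ge1$. Empty products equal $1$, empty sums equal $0$. *)

theory Defs
  imports "HOL-Analysis.Analysis"
begin

(* Throughout, the dual space of E is the type of bounded linear functionals on E; in finite
   dimension every linear functional is bounded. The gradient map is an argument: Q may have
   empty interior, and then a derivative within Q is determined only along the directions
   y - x with x, y in Q. Nothing below depends on its values along other directions. *)

definition is_gradient_on ::
  "'a::real_normed_vector set \<Rightarrow> ('a \<Rightarrow> real) \<Rightarrow> ('a \<Rightarrow> 'a \<Rightarrow>\<^sub>L real) \<Rightarrow> bool" where
  "is_gradient_on Q h grad \<longleftrightarrow>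
     (\<forall>x\<in>Q. (h has_derivative blinfun_apply (grad x)) (at x within Q))"

definition curvature_bound ::
  "'a::real_normed_vector set \<Rightarrow> ('a \<Rightarrow> real) \<Rightarrow> ('a \<Rightarrow> 'a \<Rightarrow>\<^sub>L real) \<Rightarrow> real \<Rightarrow> bool" where
  "curvature_bound Q h grad C \<longleftrightarrow>
     (\<forall>x\<in>Q. \<forall>y\<in>Q. \<forall>a\<in>{0..1}.
        h (x + a *\<^sub>R (y - x))
          \<ge> h x + blinfun_apply (grad x) (a *\<^sub>R (y - x)) - 1/2 * C * a\<^sup>2)"

definition curvature_finite ::
  "'a::real_normed_vector set \<Rightarrow> ('a \<Rightarrow> real) \<Rightarrow> ('a \<Rightarrow> 'a \<Rightarrow>\<^sub>L real) \<Rightarrow> bool" where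
  "curvature_finite Q h grad \<longleftrightarrow> (\<exists>C. curvature_bound Q h grad C)"

(* Meaningful under curvature_finite, for Q nonempty and h concave: every bound is then \<ge> 0, and
   the bounds form a closed set, so the least one exists. *)
definition curvature_const ::
  "'a::real_normed_vector set \<Rightarrow> ('a \<Rightarrow> real) \<Rightarrow> ('a \<Rightarrow> 'a \<Rightarrow>\<^sub>L real) \<Rightarrow> real" where
  "curvature_const Q h grad = (LEAST C. curvature_bound Q h grad C)"

definition approx_solution ::
  "'a::real_normed_vector set \<Rightarrow> ('a \<Rightarrow>\<^sub>L real) \<Rightarrow> real \<Rightarrow> 'a \<Rightarrow> bool" where
  "approx_solution Q c d x \<longleftrightarrow>
     x \<in> Q \<and> blinfun_apply c x \<ge> (SUP y\<in>Q. blinfun_apply c y) - d"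

definition wolfe_bound ::
  "('a::real_normed_vector \<Rightarrow> real) \<Rightarrow> ('a \<Rightarrow> 'a \<Rightarrow>\<^sub>L real) \<Rightarrow> real \<Rightarrow> 'a \<Rightarrow> 'a \<Rightarrow> real" where
  "wolfe_bound h grad d x y = h x + blinfun_apply (grad x) (y - x) + d"

(* Iterates lam k, lamt k, accuracies d k, step-sizes abar k and optional bounds Bo k are indexed
   by k \<ge> 1 (their value at 0 is irrelevant), the upper bounds B k by k \<ge> 0.
   An initial or optional bound that is not available is \<infinity>. *)
definition frank_wolfe ::
  "'a::real_normed_vector set \<Rightarrow> ('a \<Rightarrow> real) \<Rightarrow> ('a \<Rightarrow> 'a \<Rightarrow>\<^sub>L real)
     \<Rightarrow> (nat \<Rightarrow> real) \<Rightarrow> (nat \<Rightarrow> real) \<Rightarrow> (nat \<Rightarrow> ereal)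
     \<Rightarrow> (nat \<Rightarrow> 'a) \<Rightarrow> (nat \<Rightarrow> 'a) \<Rightarrow> (nat \<Rightarrow> ereal) \<Rightarrow> bool" where
  "frank_wolfe Q h grad d abar Bo lam lamt B \<longleftrightarrow>
     lam 1 \<in> Q \<and>
     B 0 \<ge> ereal (SUP x\<in>Q. h x) \<and>
     (\<forall>k\<ge>1.
        approx_solution Q (grad (lam k)) (d k) (lamt k) \<and>
        Bo k \<ge> ereal (SUP x\<in>Q. h x) \<and>
        B k = min (B (k - 1)) (min (ereal (wolfe_bound h grad (d k) (lam k) (lamt k))) (Bo k)) \<and>
        lam (k + 1) = lam k + abar k *\<^sub>R (lamt k - lam k))"

definition da_beta :: "(nat \<Rightarrow> real) \<Rightarrow> nat \<Rightarrow> real" where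
  "da_beta abar k = 1 / (\<Prod>j=1..<k. 1 - abar j)"

definition da_alpha :: "(nat \<Rightarrow> real) \<Rightarrow> nat \<Rightarrow> real" where
  "da_alpha abar k = da_beta abar k * abar k / (1 - abar k)"

end

(* Fix k and a real b not above the Wolfe bounds of the iterations i = 1..k. The curvature inequality
   along the step from lam i to lamt i reads
     b - h (lam (i+1)) <= (1 - abar i) (b - h (lam i)) + abar i * d i + C/2 * (abar i)^2.
   Since 1 / beta (i+1) = (1 - abar i) / beta i and alpha i / beta (i+1) = abar i, unrolling this
   recursion gives the claim for b, and b := B k is admissible because B is decreasing. *)

theory Submission
  imports Defs
begin

text \<open>The admissible constants form a nonempty set that is an intersection of closed
  conditions on \<open>C\<close> and is bounded below by 0, so its infimum is itself admissible.
  This turns the \<open>LEAST\<close> in \<open>curvature_const\<close> into a usable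
  inequality.\<close>

lemma curvature_bound_curvature_const:
  assumes "Q \<noteq> {}" and fin: "curvature_finite Q h grad"
  shows "curvature_bound Q h grad (curvature_const Q h grad)"
proof -
  define S where "S = {C. curvature_bound Q h grad C}"
  have ne: "S \<noteq> {}"
    using fin by (auto simp: S_def curvature_finite_def)
  obtain z where z: "z \<in> Q" using \<open>Q \<noteq> {}\<close> by auto
  have "0 \<le> C" if "C \<in> S" for C
  proof -
    \<comment> \<open>The degenerate choice x = y = z with full step 1 cancels everything except
      \<open>C\<close>, leaving 0 \<le> C/2.\<close>
    have "h (z + 1 *\<^sub>R (z - z)) \<ge> h z + blinfun_apply (grad z) (1 *\<^sub>R (z - z)) - 1/2 * C * 1\<^sup>2"
      using that z by (auto simp: S_def curvature_bound_def dest!: bspec[of _ _ z] bspec[of _ _ 1])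
    then show ?thesis by simp
  qed
  then have bdd: "bdd_below S" by (rule bdd_belowI)
  have bound: "curvature_bound Q h grad (Inf S)"
    unfolding curvature_bound_def
  proof (intro ballI)
    fix x y and a :: real
    assume x: "x \<in> Q" and y: "y \<in> Q" and a: "a \<in> {0..1}"
    define u where "u = h x + blinfun_apply (grad x) (a *\<^sub>R (y - x)) - h (x + a *\<^sub>R (y - x))"
    have le: "u \<le> 1/2 * C * a\<^sup>2" if "C \<in> S" for C
    proof -
      have "h (x + a *\<^sub>R (y - x)) \<ge> h x + blinfun_apply (grad x) (a *\<^sub>R (y - x)) - 1/2 * C * a\<^sup>2"
        using that x y a unfolding S_def curvature_bound_def by blast
      then show ?thesis by (simp add: u_def)
    qed
    \<comment> \<open>For a = 0 the right-hand side is 0 whatever the constant, so any member of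
      \<open>S\<close> settles it. Otherwise the inequality is solved for \<open>C\<close>, which
      makes \<open>2 * u / a\<^sup>2\<close> a lower bound of \<open>S\<close>.\<close>
    have "u \<le> 1/2 * Inf S * a\<^sup>2"
    proof (cases "a = 0")
      case True
      then show ?thesis using le ne by auto
    next
      case False
      then have "2 * u / a\<^sup>2 \<le> C" if "C \<in> S" for C
        using le[OF that] by (simp add: field_simps)
      then have "2 * u / a\<^sup>2 \<le> Inf S"
        by (rule cInf_greatest[OF ne])
      with False show ?thesis by (simp add: field_simps)
    qed
    then show "h (x + a *\<^sub>R (y - x))
        \<ge> h x + blinfun_apply (grad x) (a *\<^sub>R (y - x)) - 1/2 * Inf S * a\<^sup>2"
      by (simp add: u_def)
  qed
  have "curvature_const Q h grad = Inf S"
    unfolding curvature_const_def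
    by (rule Least_equality) (use bound bdd in \<open>auto simp: S_def intro: cInf_lower\<close>)
  with bound show ?thesis by simp
qed

lemma da_beta_1 [simp]: "da_beta abar (Suc 0) = 1"
  by (simp add: da_beta_def)

lemma da_beta_Suc: "k \<ge> 1 \<Longrightarrow> da_beta abar (Suc k) = da_beta abar k / (1 - abar k)"
  by (simp add: da_beta_def)

lemma da_beta_pos:
  assumes "\<And>i. 1 \<le> i \<Longrightarrow> i < k \<Longrightarrow> abar i < 1"
  shows "da_beta abar k > 0"
  using assms by (auto simp: da_beta_def intro!: prod_pos)

text \<open>Each new iterate is a convex combination of two points of \<open>Q\<close>. Membership
  is what allows the curvature inequality to be applied at \<open>lam k\<close>.\<close>

lemma frank_wolfe_iterates_mem:
  assumes fw: "frank_wolfe Q h grad d abar Bo lam lamt B" and "convex Q"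
    and abar: "\<And>i. i \<ge> 1 \<Longrightarrow> 0 \<le> abar i \<and> abar i < 1"
    and "k \<ge> 1"
  shows "lam k \<in> Q"
  using \<open>k \<ge> 1\<close>
proof (induction k rule: dec_induct)
  case base
  then show ?case using fw by (simp add: frank_wolfe_def)
next
  case (step n)
  then have "lamt n \<in> Q"
    using fw by (simp add: frank_wolfe_def approx_solution_def)
  with step have "(1 - abar n) *\<^sub>R lam n + abar n *\<^sub>R lamt n \<in> Q"
    using abar[of n] \<open>convex Q\<close> by (intro convexD) auto
  moreover have "lam (Suc n) = (1 - abar n) *\<^sub>R lam n + abar n *\<^sub>R lamt n"
    using fw step by (simp add: frank_wolfe_def algebra_simps)
  ultimately show ?case by simp
qed

lemma frank_wolfe_bound_antimono:
  assumes fw: "frank_wolfe Q h grad d abar Bo lam lamt B" and "m \<le> n"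
  shows "B n \<le> B m"
proof -
  have "B (Suc j) \<le> B j" for j
    using fw by (simp add: frank_wolfe_def)
  then show ?thesis using \<open>m \<le> n\<close> by (rule lift_Suc_antimono_le)
qed

lemma frank_wolfe_bound_le_wolfe_bound:
  assumes fw: "frank_wolfe Q h grad d abar Bo lam lamt B" and "1 \<le> i" "i \<le> k"
  shows "B k \<le> ereal (wolfe_bound h grad (d i) (lam i) (lamt i))"
proof -
  have "B k \<le> B i" using fw \<open>i \<le> k\<close> by (rule frank_wolfe_bound_antimono)
  also have "B i = min (B (i - 1)) (min (ereal (wolfe_bound h grad (d i) (lam i) (lamt i))) (Bo i))"
    using fw \<open>1 \<le> i\<close> by (simp add: frank_wolfe_def)
  also have "\<dots> \<le> ereal (wolfe_bound h grad (d i) (lam i) (lamt i))"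
    by (simp add: min_le_iff_disj)
  finally show ?thesis .
qed

text \<open>The hypothesis on \<open>b\<close> says that the slope
  \<open>blinfun_apply (grad x) (y - x)\<close> is at least \<open>b - h x - \<delta>\<close>;
  scaled by a \<ge> 0, this is inserted into the curvature inequality.\<close>

lemma frank_wolfe_gap_step:
  assumes curv: "curvature_bound Q h grad C"
    and "x \<in> Q" "y \<in> Q" "0 \<le> a" "a \<le> 1"
    and b: "b \<le> wolfe_bound h grad \<delta> x y"
  shows "b - h (x + a *\<^sub>R (y - x)) \<le> (1 - a) * (b - h x) + a * \<delta> + 1/2 * C * a\<^sup>2"
proof -
  have "h (x + a *\<^sub>R (y - x)) \<ge> h x + a * blinfun_apply (grad x) (y - x) - 1/2 * C * a\<^sup>2"
    using assms by (simp add: curvature_bound_def blinfun.scaleR_right)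
  moreover have "a * (b - h x - \<delta>) \<le> a * blinfun_apply (grad x) (y - x)"
    using b \<open>0 \<le> a\<close> by (intro mult_left_mono) (simp_all add: wolfe_bound_def)
  ultimately show ?thesis by (simp add: algebra_simps)
qed

text \<open>The induction runs with one fixed real \<open>b\<close>, because \<open>B k\<close>
  itself changes with \<open>k\<close> and may be infinite. The hypothesis on \<open>b\<close>
  depends on \<open>k\<close> and is therefore carried through the induction.\<close>

lemma frank_wolfe_gap:
  fixes b C :: real
  assumes fw: "frank_wolfe Q h grad d abar Bo lam lamt B" and "convex Q"
    and curv: "curvature_bound Q h grad C"
    and abar: "\<And>i. i \<ge> 1 \<Longrightarrow> 0 \<le> abar i \<and> abar i < 1"
    and "\<And>i. 1 \<le> i \<Longrightarrow> i \<le> k \<Longrightarrow> b \<le> wolfe_bound h grad (d i) (lam i) (lamt i)"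
  shows "b - h (lam (k + 1)) \<le> (b - h (lam 1)) / da_beta abar (k + 1)
      + 1/2 * C * (\<Sum>i=1..k. (da_alpha abar i)\<^sup>2 / da_beta abar (i + 1)) / da_beta abar (k + 1)
      + (\<Sum>i=1..k. da_alpha abar i * d i) / da_beta abar (k + 1)"
  using assms(5)
proof (induction k)
  case 0
  then show ?case by simp
next
  case (Suc k)
  define a where "a = abar (Suc k)"
  define \<beta> where "\<beta> = da_beta abar (Suc k)"
  define X where "X = (\<Sum>i=1..k. (da_alpha abar i)\<^sup>2 / da_beta abar (i + 1))"
  define Y where "Y = (\<Sum>i=1..k. da_alpha abar i * d i)"
  have a: "0 \<le> a" "a < 1" using abar[of "Suc k"] by (auto simp: a_def)
  have \<beta>: "\<beta> > 0" unfolding \<beta>_def using abar by (intro da_beta_pos) auto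
  have \<beta>': "da_beta abar (Suc (Suc k)) = \<beta> / (1 - a)"
    by (simp add: da_beta_Suc a_def \<beta>_def)
  have \<alpha>: "da_alpha abar (Suc k) = \<beta> * a / (1 - a)"
    by (simp add: da_alpha_def a_def \<beta>_def)
  have IH: "b - h (lam (Suc k)) \<le> (b - h (lam 1)) / \<beta> + 1/2 * C * X / \<beta> + Y / \<beta>"
    using Suc by (simp add: X_def Y_def \<beta>_def)
  have "lam (Suc k) \<in> Q"
    using fw \<open>convex Q\<close> abar by (rule frank_wolfe_iterates_mem) simp_all
  moreover have "lamt (Suc k) \<in> Q"
    using fw by (simp add: frank_wolfe_def approx_solution_def)
  moreover have "lam (Suc (Suc k)) = lam (Suc k) + a *\<^sub>R (lamt (Suc k) - lam (Suc k))"
    using fw by (simp add: frank_wolfe_def a_def)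
  ultimately have "b - h (lam (Suc (Suc k)))
      \<le> (1 - a) * (b - h (lam (Suc k))) + a * d (Suc k) + 1/2 * C * a\<^sup>2"
    using frank_wolfe_gap_step[OF curv, of "lam (Suc k)" "lamt (Suc k)" a b "d (Suc k)"] a Suc.prems
    by simp
  also have "\<dots> \<le> (1 - a) * ((b - h (lam 1)) / \<beta> + 1/2 * C * X / \<beta> + Y / \<beta>)
      + a * d (Suc k) + 1/2 * C * a\<^sup>2"
    using IH a by (intro add_right_mono mult_left_mono) auto
  \<comment> \<open>The factor 1 - a turns each denominator \<beta> into the next one, \<beta> / (1
    - a); the two terms of the current step become the last summands of the two sums.\<close>
  also have "\<dots> = (b - h (lam 1)) / (\<beta> / (1 - a))
      + 1/2 * C * (X + (\<beta> * a / (1 - a))\<^sup>2 / (\<beta> / (1 - a))) / (\<beta> / (1 - a))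
      + (Y + \<beta> * a / (1 - a) * d (Suc k)) / (\<beta> / (1 - a))"
  proof -
    have ratio: "\<beta> * a / (1 - a) / (\<beta> / (1 - a)) = a"
      using a \<beta> by simp
    \<comment> \<open>With t the new alpha and w the new beta, the last curvature summand depends
      only on t / w, which \<open>ratio\<close> identifies as \<open>a\<close>.\<close>
    have "1/2 * C * (t\<^sup>2 / w) / w = 1/2 * C * (t / w)\<^sup>2" for t w :: real
      by (simp add: power2_eq_square)
    from this[of "\<beta> * a / (1 - a)" "\<beta> / (1 - a)"]
    have "1/2 * C * ((\<beta> * a / (1 - a))\<^sup>2 / (\<beta> / (1 - a))) / (\<beta> / (1 - a)) = 1/2 * C * a\<^sup>2"
      unfolding ratio .
    moreover have "\<beta> * a / (1 - a) * d (Suc k) / (\<beta> / (1 - a)) = a * d (Suc k)"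
      using ratio by (metis times_divide_eq_left)
    moreover have "(b - h (lam 1)) / (\<beta> / (1 - a)) = (1 - a) * ((b - h (lam 1)) / \<beta>)"
      and "1/2 * C * X / (\<beta> / (1 - a)) = (1 - a) * (1/2 * C * X / \<beta>)"
      and "Y / (\<beta> / (1 - a)) = (1 - a) * (Y / \<beta>)"
      by simp_all
    ultimately show ?thesis
      unfolding distrib_left add_divide_distrib by linarith
  qed
  finally show ?case
    using \<beta>' \<alpha> by (simp add: X_def Y_def)
qed

theorem theorem5p1:
  fixes Q :: "'a::real_normed_vector set"
    and h :: "'a \<Rightarrow> real"
    and grad :: "'a \<Rightarrow> 'a \<Rightarrow>\<^sub>L real"
    and d abar :: "nat \<Rightarrow> real"
    and lam lamt :: "nat \<Rightarrow> 'a"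
    and B Bo :: "nat \<Rightarrow> ereal"
    and k :: nat
  assumes "\<exists>S :: 'a set. finite S \<and> span S = UNIV"
    and "Q \<noteq> {}" and "convex Q" and "compact Q"
    and "concave_on Q h" and "is_gradient_on Q h grad"
    and "curvature_finite Q h grad"
    and "\<And>i. i \<ge> 1 \<Longrightarrow> d i \<ge> 0"
    and "\<And>i. i \<ge> 1 \<Longrightarrow> 0 \<le> abar i \<and> abar i < 1"
    and "frank_wolfe Q h grad d abar Bo lam lamt B"
  shows "B k - ereal (h (lam (k + 1)))
    \<le> (B k - ereal (h (lam 1))) / ereal (da_beta abar (k + 1))
      + ereal ((1/2 * curvature_const Q h grad
                  * (\<Sum>i=1..k. (da_alpha abar i)\<^sup>2 / da_beta abar (i + 1)))
               / da_beta abar (k + 1))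
      + ereal ((\<Sum>i=1..k. da_alpha abar i * d i) / da_beta abar (k + 1))"
proof (cases "B k")
  case (real b)
  have "b \<le> wolfe_bound h grad (d i) (lam i) (lamt i)" if "1 \<le> i" "i \<le> k" for i
    using frank_wolfe_bound_le_wolfe_bound[OF assms(10) that] real by simp
  note gap = frank_wolfe_gap[OF assms(10) \<open>convex Q\<close>
      curvature_bound_curvature_const[OF \<open>Q \<noteq> {}\<close> assms(7)] assms(9) this]
  \<comment> \<open>A nonzero denominator reduces the extended-real quotient to the real
    one.\<close>
  have "da_beta abar (k + 1) > 0"
    using assms(9) by (intro da_beta_pos) auto
  with real gap show ?thesis by simp
next
  case PInf
  \<comment> \<open>From the first iteration on, \<open>B k\<close> lies below a real Wolfe bound,
    so only the initial bound can be \<infinity>. Then the sums are empty, the denominator is 1, and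
    both sides are \<infinity>.\<close>
  have "k = 0"
  proof (rule ccontr)
    assume "k \<noteq> 0"
    then show False
      using frank_wolfe_bound_le_wolfe_bound[OF assms(10), of k k] PInf by simp
  qed
  with PInf show ?thesis by (simp flip: one_ereal_def)
next
  case MInf
  \<comment> \<open>Here the left-hand side is -\<infinity>.\<close>
  then show ?thesis by simp
qed

end
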